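(* For every integer $n\geq 1$, the number $b_n$ of involutive Baxter permutations of $2n$ elements with no fixed point is $$b_n=\frac{3\cdot 2^{n-1}}{(n+1)(n+2)}\binom{2n}{n}.$$
   Context: A permutation $\pi\in\mathfrak{S}_N$ is a Baxter permutation if it avoids the patterns $2\text{-}41\text{-}3$ and $3\text{-}14\text{-}2$, i.e. there are no indices $i<j<j+1<l$ with $\pi(j+1)<\pi(i)<\pi(l)<\pi(j)$, and no indices $i<j<j+1<l$ with $\pi(j)<\pi(l)<\pi(i)<\pi(j+1)$. It is involutive if $\pi^{-1}=\pi$. *)

theory Defs
  imports Complex_Main "HOL-Combinatorics.Permutations"
begin

text \<open>
  A permutation of \<open>N\<close> elements is a function \<open>p\<close> with \<open>p permutes {1..N}\<close>, so it is the
  identity outside \<open>{1..N}\<close>; the patterns are therefore only looked for at positions in \<open>{1..N}\<close>.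
\<close>

definition avoids_2_41_3 :: "nat \<Rightarrow> (nat \<Rightarrow> nat) \<Rightarrow> bool" where
  "avoids_2_41_3 N p \<longleftrightarrow>
     \<not> (\<exists>i j l. 1 \<le> i \<and> i < j \<and> j + 1 < l \<and> l \<le> N \<and>
          p (j + 1) < p i \<and> p i < p l \<and> p l < p j)"

definition avoids_3_14_2 :: "nat \<Rightarrow> (nat \<Rightarrow> nat) \<Rightarrow> bool" where
  "avoids_3_14_2 N p \<longleftrightarrow>
     \<not> (\<exists>i j l. 1 \<le> i \<and> i < j \<and> j + 1 < l \<and> l \<le> N \<and>
          p j < p l \<and> p l < p i \<and> p i < p (j + 1))"

definition baxter_perm :: "nat \<Rightarrow> (nat \<Rightarrow> nat) \<Rightarrow> bool" where
  "baxter_perm N p \<longleftrightarrow> p permutes {1..N} \<and> avoids_2_41_3 N p \<and> avoids_3_14_2 N p"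

definition involutive_perm :: "(nat \<Rightarrow> nat) \<Rightarrow> bool" where
  "involutive_perm p \<longleftrightarrow> inv p = p"

end

theory Submission
  imports Defs
begin

text \<open>The proof has two halves: a generating tree with two labels for the involutions, and a reflection
argument on \<open>\<int>\<^sup>2\<close> that solves its recurrence.

Deleting the cycle \<open>(p, N + 2)\<close> from a fixed-point-free Baxter involution of \<open>{1..N+2}\<close> and closing the
gaps leaves a fixed-point-free Baxter involution \<open>s\<close> of \<open>{1..N}\<close>. Conversely, the cycle may be inserted
exactly at the positions \<open>p\<close> that are a left-to-right maximum of \<open>s\<close>, that directly follow a
right-to-left maximum \<open>m\<close> with \<open>s m > m\<close>, or that are last (\<open>avoids_add_cycle_imp\<close>,
\<open>avoids_add_cycle_imp_site\<close>, \<open>avoids_add_cycle\<close>). If \<open>i\<close> and \<open>j\<close> are the numbers of maxima of the two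
kinds, the insertions lead to the labels \<open>(k, j + 1)\<close> with \<open>1 \<le> k \<le> i\<close>, to \<open>(i + 1, k)\<close> with
\<open>1 \<le> k \<le> j\<close>, and once more to \<open>(i + 1, 1)\<close> (\<open>sum_active_sites\<close>).

Let \<open>D\<^sub>n(a, b)\<close> be the sum of \<open>binom(i - 1, a - 1) binom(j - 1, b - 1)\<close> over the involutions of
\<open>2n\<close> points, for \<open>a, b \<ge> 1\<close>; the number sought is \<open>D\<^sub>n(1, 1)\<close>. In terms of \<open>D\<close> the tree becomes a walk
in the quadrant \<open>a, b \<ge> 1\<close> of the triangular lattice: \<open>D\<^bsub>n+1\<^esub>(a, b)\<close> is \<open>2 D\<^sub>n(a, b)\<close> plus the values of \<open>D\<^sub>n\<close> at
the six neighbours of \<open>(a, b)\<close>, provided that values on the boundary are read by the rules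
\<open>D\<^sub>n(0, b) = 0\<close> and \<open>D\<^sub>n(a + 1, 0) = D\<^sub>n(a, 1)\<close>.

The boundary rules are enforced by reflection. The function \<open>start\<close> on all of \<open>\<int>\<^sup>2\<close> agrees with \<open>D\<^sub>1\<close>
inside the quadrant and has two antisymmetries (\<open>antisym_left\<close>, \<open>antisym_bottom\<close>), which the
unrestricted step \<open>hex_step\<close> preserves and which imply the two rules. Hence
\<open>D\<^bsub>n+1\<^esub> = hex_step\<^sup>n start\<close> inside the quadrant (\<open>label_moment_eq_walk\<close>).

It remains to evaluate \<open>hex_step\<^sup>n start\<close> at \<open>(1, 1)\<close>. Around that point, \<open>start\<close> is a signed sum of two
points and eight lattice rays. Since \<open>hex_step\<close> commutes with the twelve symmetries of the hexagon, a
ray may be replaced by any of its images, and a ray together with its mirror image fills a row of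
the lattice. All incomplete contributions cancel, and only four complete rows are left
(\<open>walk_one_one_rows\<close>). On functions constant along rows, \<open>hex_step\<close> is twice the convolution with
\<open>(1, 2, 1)\<close>, so that every row contributes a binomial coefficient.\<close>

section \<open>Removing a cycle from an involution\<close>

text \<open>Being the identity outside \<open>{1..N}\<close> is part of the notion, so that involutions are determined by
their values on \<open>{1..N}\<close>.\<close>

definition fpf_involution :: "nat \<Rightarrow> (nat \<Rightarrow> nat) \<Rightarrow> bool" where
  "fpf_involution N s \<longleftrightarrow> (\<forall>k. s (s k) = k) \<and> (\<forall>k\<in>{1..N}. s k \<in> {1..N} \<and> s k \<noteq> k)
     \<and> (\<forall>k. k \<notin> {1..N} \<longrightarrow> s k = k)"

text \<open>The increasing bijection from \<open>\<nat>\<close> onto \<open>\<nat> - {p}\<close>, and its inverse. It relabels both the positions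
and the values when the cycle \<open>(p, N + 2)\<close> is inserted.\<close>

definition skip :: "nat \<Rightarrow> nat \<Rightarrow> nat" where "skip p k = (if k < p then k else k + 1)"

definition unskip :: "nat \<Rightarrow> nat \<Rightarrow> nat" where "unskip p k = (if k < p then k else k - 1)"

definition add_cycle :: "nat \<Rightarrow> (nat \<Rightarrow> nat) \<Rightarrow> nat \<Rightarrow> nat \<Rightarrow> nat" where
  "add_cycle N s p k = (if k = p then N + 2 else if k = N + 2 then p else skip p (s (unskip p k)))"

lemma skip_less_iff [simp]: "skip p x < skip p y \<longleftrightarrow> x < y"
  by (auto simp: skip_def)

lemma unskip_skip [simp]: "unskip p (skip p x) = x"
  by (auto simp: skip_def unskip_def)

lemma skip_unskip: "x \<noteq> p \<Longrightarrow> skip p (unskip p x) = x"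
  by (auto simp: skip_def unskip_def)

lemma skip_neq [simp]: "skip p x \<noteq> p"
  by (auto simp: skip_def)

lemma skip_inj [simp]: "skip p x = skip p y \<longleftrightarrow> x = y"
  by (auto simp: skip_def)

lemma skip_less_p [simp]: "skip p x < p \<longleftrightarrow> x < p"
  by (auto simp: skip_def)

lemma p_less_skip [simp]: "p < skip p x \<longleftrightarrow> p \<le> x"
  by (auto simp: skip_def)

lemma fpfD:
  assumes "fpf_involution N s"
  shows "s (s k) = k" "k \<in> {1..N} \<Longrightarrow> s k \<in> {1..N}" "k \<in> {1..N} \<Longrightarrow> s k \<noteq> k" "k \<notin> {1..N} \<Longrightarrow> s k = k"
    "s x = s y \<longleftrightarrow> x = y"
  using assms unfolding fpf_involution_def by (blast, blast, blast, blast, metis)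

lemma fpf_iff:
  "p permutes {1..N} \<and> involutive_perm p \<and> (\<forall>i\<in>{1..N}. p i \<noteq> i) \<longleftrightarrow> fpf_involution N p"
proof
  assume h: "p permutes {1..N} \<and> involutive_perm p \<and> (\<forall>i\<in>{1..N}. p i \<noteq> i)"
  then have "p (p k) = k" for k
    unfolding involutive_perm_def by (metis permutes_inverses(1))
  with h show "fpf_involution N p"
    unfolding fpf_involution_def by (auto simp: permutes_in_image permutes_not_in) (metis atLeastAtMost_iff permutes_in_image)+
next
  assume h: "fpf_involution N p"
  then have pp: "p \<circ> p = id" by (auto simp: fpfD)
  have "\<exists>!x. p x = y" for y by (metis fpfD(1)[OF h])
  then have "p permutes {1..N}" unfolding permutes_def using fpfD(4)[OF h] by blast
  moreover have "inv p = p" using pp by (simp add: inv_unique_comp)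
  ultimately show "p permutes {1..N} \<and> involutive_perm p \<and> (\<forall>i\<in>{1..N}. p i \<noteq> i)"
    using fpfD(3)[OF h] by (auto simp: involutive_perm_def)
qed

text \<open>Up to relabelling, the old values survive. The argument \<open>N + 1\<close> is left out because its relabelled
position is \<open>N + 2\<close>, which belongs to the new cycle.\<close>

lemma add_cycle_skip:
  assumes "fpf_involution N s" "p \<in> {1..N+1}" "x \<noteq> N + 1"
  shows "add_cycle N s p (skip p x) = skip p (s x)"
  using assms by (auto simp: add_cycle_def skip_def unskip_def)

lemma add_cycle_p [simp]: "add_cycle N s p p = N + 2" by (simp add: add_cycle_def)

lemma add_cycle_last: "p \<in> {1..N+1} \<Longrightarrow> add_cycle N s p (N + 2) = p" by (auto simp add: add_cycle_def)

lemma fpf_add_cycle: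
  assumes s: "fpf_involution N s" and p: "p \<in> {1..N+1}"
  shows "fpf_involution (N + 2) (add_cycle N s p)"
proof -
  have split: "k = p \<or> k = N + 2 \<or> (\<exists>x. k = skip p x \<and> x \<noteq> N + 1)" for k
    using p skip_unskip[of k p] by (cases "k = p") (auto simp: skip_def unskip_def split: if_splits intro!: exI[of _ "unskip p k"])
  have sN: "x \<noteq> N + 1 \<Longrightarrow> s x \<noteq> N + 1" for x
    using fpfD(5)[OF s, of x "N + 1"] fpfD(4)[OF s, of "N + 1"] by simp
  have shr: "skip p x \<in> {1..N+2} \<longleftrightarrow> x \<in> {1..N+1}" for x using p by (auto simp: skip_def)
  have inv: "add_cycle N s p (add_cycle N s p k) = k" for k
    using split[of k] add_cycle_last[OF p, of s]
    by (elim disjE exE conjE) (simp_all add: add_cycle_skip[OF s p] sN[simplified] fpfD(1)[OF s])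
  have rng: "add_cycle N s p k \<in> {1..N+2} \<and> add_cycle N s p k \<noteq> k" if k: "k \<in> {1..N+2}" for k
  proof -
    consider "k = p" | "k = N + 2" | x where "k = skip p x" "x \<noteq> N + 1" using split[of k] by blast
    then show ?thesis
    proof cases
      case 3
      then have "x \<in> {1..N}" using k shr[of x] by auto
      then show ?thesis using 3 fpfD[OF s, of x] shr[of "s x"] by (auto simp: add_cycle_skip[OF s p])
    qed (use p add_cycle_last[OF p, of s] in auto)
  qed
  have out: "add_cycle N s p k = k" if k: "k \<notin> {1..N+2}" for k
  proof -
    obtain x where x: "k = skip p x" "x \<noteq> N + 1" using split[of k] k p by fastforce
    then have "x \<notin> {1..N}" using k shr[of x] by auto
    then show ?thesis using x fpfD(4)[OF s, of x] by (simp add: add_cycle_skip[OF s p])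
  qed
  show ?thesis unfolding fpf_involution_def using inv rng out by blast
qed

lemma add_cycle_less:
  assumes s: "fpf_involution N s" and p: "p \<in> {1..N+1}" and k: "k \<in> {1..N+2}" "k \<noteq> p"
  shows "add_cycle N s p k < N + 2"
  using fpfD(2,5)[OF fpf_add_cycle[OF s p]] add_cycle_p[of N s p] k
  by (metis atLeastAtMost_iff le_neq_implies_less)

lemma add_cycle_surj:
  assumes q: "fpf_involution (N + 2) q"
  obtains s p where "fpf_involution N s" "p \<in> {1..N+1}" "q = add_cycle N s p"
proof -
  define p where "p = q (N + 2)"
  have p: "p \<in> {1..N+1}" using fpfD(2,3)[OF q, of "N + 2"] by (auto simp: p_def)
  have qp: "q p = N + 2" by (simp add: p_def fpfD(1)[OF q])
  define s where "s k = (if k \<in> {1..N} then unskip p (q (skip p k)) else k)" for k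
  have q1: "skip p (s k) = q (skip p k)" "s k \<in> {1..N}" if k: "k \<in> {1..N}" for k
  proof -
    have shk: "skip p k \<in> {1..N+1}" using k by (auto simp: skip_def)
    have "q (skip p k) \<noteq> p" using fpfD(5)[OF q, of "skip p k" "N + 2"] shk unfolding p_def by fastforce
    moreover have "q (skip p k) \<noteq> N + 2" using fpfD(5)[OF q, of "skip p k" p] qp by simp
    moreover have "q (skip p k) \<in> {1..N+2}" using fpfD(2)[OF q, of "skip p k"] shk by auto
    ultimately show "skip p (s k) = q (skip p k)" "s k \<in> {1..N}"
      using k p by (auto simp: s_def skip_unskip) (auto simp: unskip_def)
  qed
  have s: "fpf_involution N s"
    unfolding fpf_involution_def
  proof (intro conjI ballI allI impI)
    fix k
    show "s (s k) = k"
    proof (cases "k \<in> {1..N}")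
      case True
      then have "skip p (s (s k)) = skip p k"
        using q1[of k] q1[of "s k"] fpfD(1)[OF q] by simp
      then show ?thesis by simp
    qed (auto simp: s_def)
  next
    fix k assume k: "k \<in> {1..N}"
    show "s k \<in> {1..N}" using q1[OF k] by simp
    have "skip p k \<in> {1..N+2}" using k by (auto simp: skip_def)
    then have "skip p (s k) \<noteq> skip p k" using q1[OF k] fpfD(3)[OF q, of "skip p k"] by metis
    then show "s k \<noteq> k" by auto
  qed (auto simp: s_def)
  have "q k = add_cycle N s p k" for k
  proof -
    consider "k = p" | "k = N + 2" | "k \<noteq> p" "k \<noteq> N + 2" by blast
    then show ?thesis
    proof cases
      case 3
      then have k: "k = skip p (unskip p k)" by (simp add: skip_unskip)
      show ?thesis
      proof (cases "k \<in> {1..N+2}")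
        case True
        then have "unskip p k \<in> {1..N}" using 3 p by (auto simp: unskip_def)
        then show ?thesis using q1(1) k 3 by (simp add: add_cycle_def)
      next
        case False
        then have "unskip p k \<notin> {1..N}" using 3 p by (auto simp: unskip_def)
        then show ?thesis using fpfD(4)[OF q False] k 3 by (simp add: add_cycle_def s_def)
      qed
    qed (use qp add_cycle_last[OF p, of s] in \<open>auto simp: p_def\<close>)
  qed
  then show thesis using that s p by blast
qed

lemma add_cycle_inj:
  assumes s: "fpf_involution N s" "p \<in> {1..N+1}" and t: "fpf_involution N t" "q \<in> {1..N+1}"
    and eq: "add_cycle N s p = add_cycle N t q"
  shows "s = t \<and> p = q"
proof -
  have pq: "p = q" using fun_cong[OF eq, of "N + 2"] add_cycle_last[OF s(2)] add_cycle_last[OF t(2)] by simp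
  have "s k = t k" for k
  proof (cases "k \<in> {1..N}")
    case True
    then show ?thesis
      using fun_cong[OF eq, of "skip p k"] add_cycle_skip[OF s, of k] add_cycle_skip[OF t, of k] pq by auto
  qed (use fpfD(4)[OF s(1)] fpfD(4)[OF t(1)] in auto)
  then show ?thesis using pq by blast
qed

section \<open>The sites where a cycle can be inserted\<close>

definition lr_max :: "nat \<Rightarrow> (nat \<Rightarrow> nat) \<Rightarrow> nat set" where
  "lr_max N s = {k \<in> {1..N}. \<forall>i\<in>{1..<k}. s i < s k}"

text \<open>Among the right-to-left maxima of a fixed-point-free involution, those with \<open>m < s m\<close> and those with
\<open>s m < m\<close> are exchanged by \<open>s\<close>; it suffices to record the first kind.\<close>

definition rl_exc :: "nat \<Rightarrow> (nat \<Rightarrow> nat) \<Rightarrow> nat set" where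
  "rl_exc N s = {k \<in> {1..N}. k < s k \<and> (\<forall>i\<in>{k<..N}. s i < s k)}"

lemma lr_maxD: "p \<in> lr_max N s \<Longrightarrow> p \<in> {1..N}" "p \<in> lr_max N s \<Longrightarrow> 1 \<le> i \<Longrightarrow> i < p \<Longrightarrow> s i < s p"
  by (auto simp: lr_max_def)

lemma rl_excD: "m \<in> rl_exc N s \<Longrightarrow> m \<in> {1..N}" "m \<in> rl_exc N s \<Longrightarrow> m < s m"
  "m \<in> rl_exc N s \<Longrightarrow> m < i \<Longrightarrow> i \<le> N \<Longrightarrow> s i < s m"
  by (auto simp: rl_exc_def)

definition active_sites :: "nat \<Rightarrow> (nat \<Rightarrow> nat) \<Rightarrow> nat set" where
  "active_sites N s = lr_max N s \<union> Suc ` rl_exc N s \<union> {N + 1}"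

text \<open>The two patterns exclude different positions of a new cycle; only together do they leave just the
active sites.\<close>

definition avoids :: "nat \<Rightarrow> (nat \<Rightarrow> nat) \<Rightarrow> bool" where
  "avoids N s \<longleftrightarrow> avoids_2_41_3 N s \<and> avoids_3_14_2 N s"

lemma avoidsI:
  assumes "\<And>i j l. \<lbrakk>1 \<le> i; i < j; j + 1 < l; l \<le> N; s (j + 1) < s i; s i < s l; s l < s j\<rbrakk> \<Longrightarrow> False"
    and "\<And>i j l. \<lbrakk>1 \<le> i; i < j; j + 1 < l; l \<le> N; s j < s l; s l < s i; s i < s (j + 1)\<rbrakk> \<Longrightarrow> False"
  shows "avoids N s"
  using assms unfolding avoids_def avoids_2_41_3_def avoids_3_14_2_def by meson

lemma avoidsD:
  assumes "avoids N s" "1 \<le> i" "i < j" "j + 1 < l" "l \<le> N"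
  shows "s (j + 1) < s i \<Longrightarrow> s i < s l \<Longrightarrow> s l < s j \<Longrightarrow> False"
    and "s j < s l \<Longrightarrow> s l < s i \<Longrightarrow> s i < s (j + 1) \<Longrightarrow> False"
  using assms unfolding avoids_def avoids_2_41_3_def avoids_3_14_2_def by meson+

text \<open>An occurrence in \<open>s\<close> survives in the enlarged involution unless the new position \<open>p\<close> separates its
two adjacent entries. In that case the new entry, being the largest, takes over the role of the
entry \<open>4\<close> and is again adjacent to the entry \<open>1\<close>.\<close>

lemma avoids_add_cycle_imp:
  assumes s: "fpf_involution N s" and p: "p \<in> {1..N+1}" and av: "avoids (N + 2) (add_cycle N s p)"
  shows "avoids N s"
proof (rule avoidsI)
  fix i j l
  assume h: "1 \<le> i" "i < j" "j + 1 < l" "l \<le> N"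
  have shl: "skip p l \<le> N + 2" "1 \<le> skip p i" "skip p i < skip p j" "skip p (j + 1) < skip p l"
    using h by (simp_all add: skip_def)
  have val: "add_cycle N s p (skip p x) = skip p (s x)" if "x \<le> l" for x
    using that h by (intro add_cycle_skip[OF s p]) auto
  have big: "skip p (s x) < N + 2" if "x \<in> {1..N}" for x
    using fpfD(2)[OF s that] by (auto simp: skip_def)
  { assume c: "p \<noteq> j + 1"
    then have "skip p (j + 1) = skip p j + 1" by (auto simp: skip_def)
  } note adj = this
  { assume c: "p = j + 1"
    then have "skip p j + 1 = p" "skip p (j + 1) = p + 1" by (auto simp: skip_def)
  } note gap = this
  { assume v: "s (j + 1) < s i" "s i < s l" "s l < s j"
    show False
    proof (cases "p = j + 1")
      case True
      then have "p + 1 < skip p l" using h by (simp add: skip_def)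
      then show False
        using avoidsD(1)[OF av, of "skip p i" p "skip p l"] shl gap[OF True] h v big[of l]
          val[of i] val[of "j + 1"] val[of l]
        by (simp add: True)
    next
      case False
      show False
        using avoidsD(1)[OF av, of "skip p i" "skip p j" "skip p l"] shl adj[OF False] h v
          val[of i] val[of "j + 1"] val[of l] val[of j] by simp
    qed }
  { assume v: "s j < s l" "s l < s i" "s i < s (j + 1)"
    show False
    proof (cases "p = j + 1")
      case True
      show False
        using avoidsD(2)[OF av, of "skip p i" "skip p j" "skip p l"] shl gap[OF True] h v big[of i]
          val[of i] val[of j] val[of l]
        by (simp add: True)
    next
      case False
      show False
        using avoidsD(2)[OF av, of "skip p i" "skip p j" "skip p l"] shl adj[OF False] h v
          val[of i] val[of "j + 1"] val[of l] val[of j] by simp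
    qed }
qed

text \<open>Put \<open>m = p - 1\<close>. If \<open>p\<close> is not a left-to-right maximum and \<open>s m < s p\<close>, an entry before \<open>m\<close> above \<open>s p\<close>
gives a \<open>3-14-2\<close> with the new maximum as \<open>4\<close>. If \<open>s p < s m\<close> and \<open>m\<close> is not a right-to-left maximum, an
entry after \<open>p\<close> above \<open>s m\<close> gives a \<open>2-41-3\<close>. There remains the case of a right-to-left maximum with
\<open>s m < m\<close>; there the value \<open>m\<close> occurs before the new maximum and the value \<open>m + 1\<close> at the very end, and
these two enclose the new maximum and the small entry that follows it.\<close>

lemma avoids_add_cycle_imp_site:
  assumes s: "fpf_involution N s" and p: "p \<in> {1..N+1}" and av: "avoids (N + 2) (add_cycle N s p)"
  shows "p \<in> active_sites N s"
proof (rule ccontr)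
  assume ns: "p \<notin> active_sites N s"
  then have pN: "p \<le> N" using p by (auto simp: active_sites_def)
  obtain k where k: "1 \<le> k" "k < p" "\<not> s k < s p"
    using ns p pN by (auto simp: active_sites_def lr_max_def)
  then obtain m where m: "p = m + 1" "1 \<le> m" by (cases p) auto
  have sk: "s p < s k" using k fpfD(5)[OF s, of k p] by linarith
  have lo: "add_cycle N s p x = skip p (s x)" if "x < p" for x
    using that add_cycle_skip[OF s p, of x] pN by (auto simp: skip_def)
  have hi: "add_cycle N s p (x + 1) = skip p (s x)" if "p \<le> x" "x \<le> N" for x
    using that add_cycle_skip[OF s p, of x] by (auto simp: skip_def)
  have big: "skip p (s x) < N + 2" if "x \<in> {1..N}" for x
    using fpfD(2)[OF s that] by (auto simp: skip_def)
  show False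
  proof (cases "s m < s p")
    case True
    then have "k \<noteq> m" using sk by auto
    then have "k < m" using k m by auto
    then show False
      using avoidsD(2)[OF av, of k m "p + 1"] k m pN lo[of m] lo[of k] hi[of p] True sk big[of k] by auto
  next
    case False
    then have mp: "s p < s m" using fpfD(5)[OF s, of m p] m by linarith
    show False
    proof (cases "\<exists>l\<in>{m<..N}. s m < s l")
      case True
      then obtain l where l: "l \<in> {m<..N}" "s m < s l" by blast
      then have "p < l" using mp m by (cases "l = p") auto
      then show False
        using avoidsD(1)[OF av, of m p "l + 1"] l m mp pN lo[of m] hi[of p] hi[of l] big[of l] by auto
    next
      case mx: False
      have mN: "m \<in> {1..N}" using m pN by auto
      have "m \<notin> rl_exc N s" using ns m by (auto simp: active_sites_def)
      moreover have "s i < s m" if "i \<in> {m<..N}" for i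
        using that mx fpfD(5)[OF s, of i m] by (metis greaterThanAtMost_iff linorder_neqE_nat nat_neq_iff)
      ultimately have "\<not> m < s m" using mN unfolding rl_exc_def by blast
      then have cm: "s m < m" using fpfD(3)[OF s mN] by linarith
      have c1: "s m \<in> {1..N}" using fpfD(2)[OF s mN] .
      have "add_cycle N s p (s m) = m" using lo[of "s m"] cm m fpfD(1)[OF s] by (simp add: skip_def)
      moreover have "add_cycle N s p (p + 1) = s p" using hi[of p] pN mp cm m by (simp add: skip_def)
      \<comment> \<open>the entries \<open>m\<close>, \<open>N + 2\<close>, \<open>s p\<close>, \<open>m + 1\<close> at the positions \<open>s m < p < p + 1 < N + 2\<close> form a \<open>2-41-3\<close>\<close>
      ultimately show False
        using avoidsD(1)[OF av, of "s m" p "N + 2"] c1 cm m pN mp add_cycle_last[OF p, of s] by auto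
    qed
  qed
qed

text \<open>An occurrence that uses neither of the new entries comes from \<open>s\<close>. One that uses the maximum at \<open>p\<close> as
its \<open>4\<close> is turned into an occurrence in \<open>s\<close>, or contradicts extremality, by substituting the maximum
at the site for it. One that ends in the last position, where the value is \<open>p\<close>, needs the inverse
point of view: since \<open>s\<close> is an involution, \<open>p\<close> being a left-to-right maximum means that all values
below \<open>p\<close> stand to the left of the position \<open>s p\<close> of the value \<open>p\<close>, and \<open>m\<close> being a right-to-left
maximum means that all values above \<open>m\<close> stand to the left of the position \<open>s m\<close> of the value \<open>m\<close>. Thus
the last entry can be replaced by the one at position \<open>s p\<close> or \<open>s m\<close>.\<close>

lemma avoids_add_cycle:
  assumes s: "fpf_involution N s" and av: "avoids N s" and site: "p \<in> active_sites N s"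
  shows "avoids (N + 2) (add_cycle N s p)"
proof -
  have p: "p \<in> {1..N+1}" using site by (auto simp: active_sites_def lr_max_def rl_exc_def)
  note sd = fpfD(5)[OF s] and ss = fpfD(1)[OF s] and sr = fpfD(2)[OF s]
  have pre: "\<exists>x. k = skip p x \<and> x \<in> {1..N} \<and> add_cycle N s p k = skip p (s x)"
    if "k \<in> {1..N+1}" "k \<noteq> p" for k
    using that p add_cycle_skip[OF s p, of "unskip p k"]
    by (intro exI[of _ "unskip p k"]) (auto simp: skip_unskip, auto simp: unskip_def)
  have pre2: "\<exists>x. k = skip p x \<and> k + 1 = skip p (x + 1) \<and> x \<in> {1..N} \<and> x + 1 \<in> {1..N}
       \<and> add_cycle N s p k = skip p (s x) \<and> add_cycle N s p (k + 1) = skip p (s (x + 1))"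
    if "k \<in> {1..N}" "k \<noteq> p" "k + 1 \<noteq> p" for k
  proof (intro exI[of _ "unskip p k"] conjI)
    show e: "k = skip p (unskip p k)" "k + 1 = skip p (unskip p k + 1)"
      and r: "unskip p k \<in> {1..N}" "unskip p k + 1 \<in> {1..N}"
      using that p by (auto simp: skip_def unskip_def)
    show "add_cycle N s p k = skip p (s (unskip p k))"
      by (subst e(1), rule add_cycle_skip[OF s p]) (use r in auto)
    show "add_cycle N s p (k + 1) = skip p (s (unskip p k + 1))"
      by (subst e(2), rule add_cycle_skip[OF s p]) (use r in auto)
  qed
  note max = add_cycle_less[OF s p]
  have last: "add_cycle N s p (N + 2) = p" by (rule add_cycle_last[OF p])
  consider (L) "p \<in> lr_max N s" | (R) m where "p = m + 1" "m \<in> rl_exc N s" | (E) "p = N + 1"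
    using site by (auto simp: active_sites_def)
  note kinds = this
  show ?thesis
  proof (rule avoidsI)
    fix i j l
    \<comment> \<open>In a \<open>2-41-3\<close> the new maximum can only be the \<open>4\<close> and the new last entry only the \<open>3\<close>.\<close>
    assume h: "1 \<le> i" "i < j" "j + 1 < l" "l \<le> N + 2"
      and v: "add_cycle N s p (j + 1) < add_cycle N s p i" "add_cycle N s p i < add_cycle N s p l" "add_cycle N s p l < add_cycle N s p j"
    have ne: "i \<noteq> p" "l \<noteq> p" "j + 1 \<noteq> p"
      using v max[of j] max[of i] max[of l] h by fastforce+
    obtain i' where i: "i = skip p i'" "i' \<in> {1..N}" "add_cycle N s p i = skip p (s i')"
      using pre[of i] ne h by auto
    show False
    proof (cases "l = N + 2")
      case False
      then obtain l' where l: "l = skip p l'" "l' \<in> {1..N}" "add_cycle N s p l = skip p (s l')"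
        using pre[of l] ne h by auto
      show False
      proof (cases "j = p")
        case True
        then obtain j' where j: "p + 1 = skip p j'" "add_cycle N s p (j + 1) = skip p (s j')"
          using pre[of "p + 1"] h by auto
        then have j': "j' = p" by (auto simp: skip_def split: if_splits)
        have o: "i' < p" "p < l'" using h i l j' True by (auto simp: skip_def split: if_splits)
        have w: "s p < s i'" "s i' < s l'" using v i l j j' by simp_all
        show False
        proof (cases rule: kinds)
          case L
          show False using lr_maxD(2)[OF L, of i'] o w i by simp
        next
          case (R m)
          then have m: "s l' < s m" using o l by (auto simp: rl_exc_def)
          show False
          proof (cases "i' = m")
            case False
            then show False using avoidsD(1)[OF av, of i' m l'] o w m R i l by auto
          qed (use w m in auto)
        qed (use o l in auto)
      next
        case jp: False
        then obtain j' where j: "j = skip p j'" "j + 1 = skip p (j' + 1)" "add_cycle N s p j = skip p (s j')"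
            "add_cycle N s p (j + 1) = skip p (s (j' + 1))"
          using pre2[of j] ne h False by auto
        have "skip p (j' + 1) < skip p l'" using h j l by simp
        then show False using avoidsD(1)[OF av, of i' j' l'] h v i l j by auto
      qed
    next
      case l: True
      then have lp: "add_cycle N s p l = p" using last by simp
      have si: "s i' < p" using v lp i by simp
      show False
      proof (cases "j = p")
        case True
        then have pN: "p \<le> N" using h by simp
        obtain j' where j: "p + 1 = skip p j'" "add_cycle N s p (j + 1) = skip p (s j')"
          using pre[of "p + 1"] h True pN by auto
        then have j': "j' = p" by (auto simp: skip_def split: if_splits)
        have o: "i' < p" using h i True by simp
        have w: "s p < s i'" using v i j j' by simp
        show False
        proof (cases rule: kinds)
          case L
          show False using lr_maxD(2)[OF L, of i'] o w i by simp
        next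
          case (R m)
          have m: "m \<in> {1..N}" "m < s m" "s p < s m" using R pN by (auto simp: rl_exc_def)
          have "s m \<noteq> p" using w si ss[of m] R(1) by auto
          then have c: "p < s m" "s m \<le> N" using m R(1) sr[OF m(1)] by auto
          have "i' \<noteq> m" using si m R(1) by auto
          then have "i' < m" using o R(1) by auto
          have "s i' \<noteq> m" using ss[of i'] c o by auto
          then have "s i' < m" using si R(1) by auto
          then show False
            using avoidsD(1)[OF av, of i' m "s m"] ss[of m] w m c R(1) i \<open>i' < m\<close> by auto
        qed (use pN in auto)
      next
        case jp: False
        then have "j \<le> N" using h l by simp
        then obtain j' where j: "j = skip p j'" "j + 1 = skip p (j' + 1)" "add_cycle N s p j = skip p (s j')"
            "add_cycle N s p (j + 1) = skip p (s (j' + 1))" "j' \<in> {1..N}" "j' + 1 \<in> {1..N}"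
          using pre2[of j] ne h jp by auto
        have o: "i' < j'" using h i j by simp
        have w: "s (j' + 1) < s i'" "p \<le> s j'" using v i j lp by simp_all
        show False
        proof (cases rule: kinds)
          case L
          have bef: "k < s p" if "k \<in> {1..N}" "s k < p" for k
            using lr_maxD(2)[OF L, of "s k"] that sr[OF that(1)] ss[of k] by auto
          have "j' + 1 < s p" using bef[of "j' + 1"] j w si by auto
          moreover have "s p \<in> {1..N}" using L sr[of p] by (auto simp: lr_max_def)
          ultimately show False
            using avoidsD(1)[OF av, of i' j' "s p"] i o w si ss[of p] ss[of j'] by fastforce
        next
          case (R m)
          have m: "m \<in> {1..N}" "m < s m" "s m \<in> {1..N}" using R sr[of m] by (auto simp: rl_exc_def)
          have bef: "k < s m" if "k \<in> {1..N}" "m < s k" for k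
            using rl_excD(3)[OF R(2), of "s k"] that sr[OF that(1)] ss[of k] by auto
          have "j' < s m" using bef[of j'] j w R(1) by auto
          moreover have "s i' \<noteq> m" using ss[of i'] o \<open>j' < s m\<close> by auto
          then have "s i' < m" using si R(1) by auto
          moreover then have "j' + 1 \<noteq> s m" using w ss[of m] by auto
          ultimately show False
            using avoidsD(1)[OF av, of i' j' "s m"] i o w m R(1) ss[of m] by auto
        next
          case E
          then show False using w sr[OF j(5)] by auto
        qed
      qed
    qed
  next
    fix i j l
    \<comment> \<open>In a \<open>3-14-2\<close> the new maximum can only be the \<open>4\<close> and the new last entry only the \<open>2\<close>.\<close>
    assume h: "1 \<le> i" "i < j" "j + 1 < l" "l \<le> N + 2"
      and v: "add_cycle N s p j < add_cycle N s p l" "add_cycle N s p l < add_cycle N s p i" "add_cycle N s p i < add_cycle N s p (j + 1)"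
    have ne: "i \<noteq> p" "l \<noteq> p" "j \<noteq> p"
      using v max[of "j + 1"] max[of i] max[of l] h by fastforce+
    obtain i' where i: "i = skip p i'" "i' \<in> {1..N}" "add_cycle N s p i = skip p (s i')"
      using pre[of i] ne h by auto
    show False
    proof (cases "j + 1 = p")
      case True
      have j: "add_cycle N s p j = skip p (s j)" "j \<in> {1..N}"
        using pre[of j] ne h True by (auto simp: skip_def split: if_splits)
      have o: "i' < j" using h i True by (auto simp: skip_def split: if_splits)
      show False
      proof (cases "l = N + 2")
        case False
        then obtain l' where l: "l = skip p l'" "l' \<in> {1..N}" "add_cycle N s p l = skip p (s l')"
          using pre[of l] ne h by auto
        have ol: "p \<le> l'" using h l True by simp
        have w: "s j < s l'" "s l' < s i'" using v i l j by simp_all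
        show False
        proof (cases rule: kinds)
          case L
          then have "s i' < s p" using o True i by (auto simp: lr_max_def)
          moreover then have "l' \<noteq> p" using w by auto
          ultimately show False using avoidsD(2)[OF av, of i' j l'] o w ol l i True by auto
        next
          case (R m)
          then show False using w ol l True rl_excD(3)[OF R(2), of l'] by auto
        qed (use ol l in auto)
      next
        case l: True
        then have lp: "add_cycle N s p l = p" using last by simp
        have w: "s j < p" "p \<le> s i'" using v lp i j by simp_all
        show False
        proof (cases rule: kinds)
          case L
          then have ip: "s i' < s p" using o True i by (auto simp: lr_max_def)
          have "s p \<in> {1..N}" using L sr[of p] by (auto simp: lr_max_def)
          moreover have "s i' \<noteq> p" using ss[of i'] ip w o True by auto
          ultimately show False
            using avoidsD(2)[OF av, of i' j "s p"] o w ip ss[of p] i True by auto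
        next
          case (R m)
          then show False using w True by (auto simp: rl_exc_def)
        next
          case E
          then show False using w sr[OF i(2)] by auto
        qed
      qed
    next
      case jp: False
      have "j \<le> N" using h by simp
      then obtain j' where j: "j = skip p j'" "j + 1 = skip p (j' + 1)" "add_cycle N s p j = skip p (s j')"
          "add_cycle N s p (j + 1) = skip p (s (j' + 1))" "j' \<in> {1..N}" "j' + 1 \<in> {1..N}"
        using pre2[of j] ne h jp by auto
      have o: "i' < j'" using h i j by simp
      show False
      proof (cases "l = N + 2")
        case False
        then obtain l' where l: "l = skip p l'" "l' \<in> {1..N}" "add_cycle N s p l = skip p (s l')"
          using pre[of l] ne h by auto
        have "skip p (j' + 1) < skip p l'" using h j l by simp
        then show False using avoidsD(2)[OF av, of i' j' l'] h v i l j by auto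
      next
        case l: True
        then have lp: "add_cycle N s p l = p" using last by simp
        have w: "s j' < p" "p \<le> s i'" "s i' < s (j' + 1)" using v lp i j by simp_all
        show False
        proof (cases rule: kinds)
          case L
          have bef: "k < s p" if "k \<in> {1..N}" "s k < p" for k
            using lr_maxD(2)[OF L, of "s k"] that sr[OF that(1)] ss[of k] by auto
          have jq: "j' < s p" using bef[of j'] j w by auto
          moreover have "j' + 1 \<noteq> s p" using w ss[of p] by auto
          moreover have "s p \<in> {1..N}" using L sr[of p] by (auto simp: lr_max_def)
          moreover have "s i' \<noteq> p" using ss[of i'] jq o by auto
          ultimately show False
            using avoidsD(2)[OF av, of i' j' "s p"] i o w ss[of p] by auto
        next
          case (R m)
          have m: "m \<in> {1..N}" "m < s m" "s m \<in> {1..N}" using R sr[of m] by (auto simp: rl_exc_def)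
          have bef: "k < s m" if "k \<in> {1..N}" "m < s k" for k
            using rl_excD(3)[OF R(2), of "s k"] that sr[OF that(1)] ss[of k] by auto
          have jc: "j' + 1 < s m" using bef[of "j' + 1"] j w R(1) by auto
          moreover have "s j' \<noteq> m" using ss[of j'] jc by auto
          ultimately show False
            using avoidsD(2)[OF av, of i' j' "s m"] i o w m R(1) ss[of m] by auto
        next
          case E
          then show False using w sr[OF i(2)] by auto
        qed
      qed
    qed
  qed
qed

section \<open>The generating tree\<close>

lemma lr_max_le_rl_exc: "k \<in> lr_max N s \<Longrightarrow> m \<in> rl_exc N s \<Longrightarrow> k \<le> m"
  using lr_maxD(2)[of k N s m] lr_maxD(1)[of k N s] rl_excD(1)[of m N s] rl_excD(3)[of m N s k] by fastforce

text \<open>Nothing after the new maximum can be a left-to-right maximum.\<close>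

lemma lr_max_add_cycle:
  assumes s: "fpf_involution N s" and p: "p \<in> {1..N+1}"
  shows "lr_max (N + 2) (add_cycle N s p) = insert p {k \<in> lr_max N s. k < p}"
proof -
  have lo: "add_cycle N s p x = skip p (s x)" if "x < p" for x
    using that add_cycle_skip[OF s p, of x] p by (auto simp: skip_def)
  note hi = add_cycle_less[OF s p]
  have "k \<in> lr_max (N + 2) (add_cycle N s p) \<longleftrightarrow> k = p \<or> k \<in> lr_max N s \<and> k < p" for k
  proof -
    consider "k < p" | "k = p" | "p < k" by linarith
    then show ?thesis
    proof cases
      case 1
      then show ?thesis using p lo by (auto simp: lr_max_def)
    next
      case 2
      then show ?thesis using p hi by (auto simp: lr_max_def)
    next
      case 3
      have "k \<notin> lr_max (N + 2) (add_cycle N s p)"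
      proof
        assume k: "k \<in> lr_max (N + 2) (add_cycle N s p)"
        show False using lr_maxD(2)[OF k, of p] lr_maxD(1)[OF k] hi[of k] 3 p by simp
      qed
      then show ?thesis using 3 by auto
    qed
  qed
  then show ?thesis by blast
qed

text \<open>The maximum hides everything on its left. On its right nothing is lost: the last entry has value \<open>p\<close>,
which is smaller than the value of any excedance at a position beyond \<open>p\<close>.\<close>

lemma rl_exc_add_cycle:
  assumes s: "fpf_involution N s" and p: "p \<in> {1..N+1}"
  shows "rl_exc (N + 2) (add_cycle N s p) = insert p (Suc ` {k \<in> rl_exc N s. p \<le> k})"
proof -
  have up: "add_cycle N s p (x + 1) = skip p (s x)" if "p \<le> x" "x \<le> N" for x
    using that add_cycle_skip[OF s p, of x] p by (auto simp: skip_def)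
  note hi = add_cycle_less[OF s p]
  note last = add_cycle_last[OF p, of s]
  have "k \<in> rl_exc (N + 2) (add_cycle N s p) \<longleftrightarrow> k = p \<or> (\<exists>x. k = x + 1 \<and> x \<in> rl_exc N s \<and> p \<le> x)" for k
  proof -
    consider "k < p" | "k = p" | "k = N + 2" | x where "k = x + 1" "p \<le> x" "x \<le> N" | "N + 2 < k"
      using p by (cases k) (auto, linarith)
    then show ?thesis
    proof cases
      case 1
      have "k \<notin> rl_exc (N + 2) (add_cycle N s p)"
      proof
        assume k: "k \<in> rl_exc (N + 2) (add_cycle N s p)"
        show False using rl_excD(3)[OF k, of p] rl_excD(1)[OF k] hi[of k] 1 p by simp
      qed
      then show ?thesis using 1 by auto
    next
      case 2
      then show ?thesis using p hi by (auto simp: rl_exc_def)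
    next
      case 3
      then show ?thesis using last p rl_excD(2)[of k "N + 2" "add_cycle N s p"] rl_excD(1)[of "N + 1" N s] by auto
    next
      case (4 x)
      have x: "add_cycle N s p k = skip p (s x)" using 4 up by simp
      have sx: "x < s x \<longleftrightarrow> k < skip p (s x)" using 4 by (auto simp: skip_def)
      show ?thesis
      proof
        assume k: "k \<in> rl_exc (N + 2) (add_cycle N s p)"
        have "s i < s x" if "x < i" "i \<le> N" for i
          using rl_excD(3)[OF k, of "i + 1"] that 4 x up[of i] by simp
        then have "x \<in> rl_exc N s" using rl_excD(2)[OF k] x sx 4 p by (auto simp: rl_exc_def)
        then show "k = p \<or> (\<exists>x. k = x + 1 \<and> x \<in> rl_exc N s \<and> p \<le> x)" using 4 by blast
      next
        assume "k = p \<or> (\<exists>x. k = x + 1 \<and> x \<in> rl_exc N s \<and> p \<le> x)"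
        then have r: "x \<in> rl_exc N s" using 4 by auto
        have "add_cycle N s p i < add_cycle N s p k" if i: "k < i" "i \<le> N + 2" for i
        proof (cases "i = N + 2")
          case True
          then show ?thesis using last x rl_excD(2)[OF r] 4 by (simp add: skip_def)
        next
          case False
          then obtain y where y: "i = y + 1" "x < y" "y \<le> N" using i 4 by (cases i) auto
          then show ?thesis using up[of y] rl_excD(3)[OF r, of y] 4 x by simp
        qed
        then show "k \<in> rl_exc (N + 2) (add_cycle N s p)"
          using rl_excD(2)[OF r] x sx 4 p by (auto simp: rl_exc_def)
      qed
    next
      case 5
      then show ?thesis using p rl_excD(1)[of k "N + 2"] rl_excD(1)[of _ N s] by fastforce
    qed
  qed
  then show ?thesis by auto
qed

definition baxter_involutions :: "nat \<Rightarrow> (nat \<Rightarrow> nat) set" where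
  "baxter_involutions N = {s. fpf_involution N s \<and> avoids N s}"

lemma finite_baxter_involutions: "finite (baxter_involutions N)"
proof (rule finite_subset)
  show "baxter_involutions N \<subseteq> {p. p permutes {1..N}}" using fpf_iff by (auto simp: baxter_involutions_def)
qed (simp add: finite_permutations)

lemma baxter_involutions_step:
  "bij_betw (\<lambda>(s, p). add_cycle N s p) (Sigma (baxter_involutions N) (active_sites N)) (baxter_involutions (N + 2))"
proof (rule bij_betw_imageI)
  have st: "active_sites N s \<subseteq> {1..N+1}" for s by (auto simp: active_sites_def lr_max_def rl_exc_def)
  show "inj_on (\<lambda>(s, p). add_cycle N s p) (Sigma (baxter_involutions N) (active_sites N))"
    using add_cycle_inj st unfolding inj_on_def baxter_involutions_def by (auto simp del: One_nat_def, (blast | metis subsetD)+)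
  show "(\<lambda>(s, p). add_cycle N s p) ` Sigma (baxter_involutions N) (active_sites N) = baxter_involutions (N + 2)"
  proof (intro equalityI subsetI)
    fix q assume "q \<in> (\<lambda>(s, p). add_cycle N s p) ` Sigma (baxter_involutions N) (active_sites N)"
    then show "q \<in> baxter_involutions (N + 2)" using st fpf_add_cycle avoids_add_cycle by (fastforce simp: baxter_involutions_def)
  next
    fix q assume q: "q \<in> baxter_involutions (N + 2)"
    then obtain s p where "fpf_involution N s" "p \<in> {1..N+1}" "q = add_cycle N s p"
      using add_cycle_surj unfolding baxter_involutions_def by (metis mem_Collect_eq)
    then have "s \<in> baxter_involutions N \<and> p \<in> active_sites N s \<and> q = add_cycle N s p"
      using avoids_add_cycle_imp avoids_add_cycle_imp_site q unfolding baxter_involutions_def by blast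
    then show "q \<in> (\<lambda>(s, p). add_cycle N s p) ` Sigma (baxter_involutions N) (active_sites N)" by force
  qed
qed

text \<open>Ranking the elements of a finite set is a bijection onto an initial segment; this turns a choice of
a maximum into a choice of a new label.\<close>

lemma sum_rank_up:
  fixes A :: "nat set" and f :: "nat \<Rightarrow> 'b::comm_monoid_add"
  assumes "finite A"
  shows "(\<Sum>a\<in>A. f (card {k \<in> A. k < a})) = (\<Sum>k<card A. f k)"
  using assms
proof (induction A rule: finite_linorder_max_induct)
  case (insert b A)
  have 1: "{k \<in> insert b A. k < b} = A" using insert by auto
  have 2: "{k \<in> insert b A. k < a} = {k \<in> A. k < a}" if "a \<in> A" for a
    using insert that by fastforce
  have nb: "b \<notin> A" using insert by auto
  show ?case using insert nb by (simp add: 1 2 add.commute del: insert_iff cong: sum.cong)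
qed simp

lemma sum_rank_down:
  fixes A :: "nat set" and f :: "nat \<Rightarrow> 'b::comm_monoid_add"
  assumes "finite A"
  shows "(\<Sum>a\<in>A. f (card {k \<in> A. a < k})) = (\<Sum>k<card A. f k)"
  using assms
proof (induction A rule: finite_linorder_min_induct)
  case (insert b A)
  have 1: "{k \<in> insert b A. b < k} = A" using insert by auto
  have 2: "{k \<in> insert b A. a < k} = {k \<in> A. a < k}" if "a \<in> A" for a
    using insert that by fastforce
  have nb: "b \<notin> A" using insert by auto
  show ?case using insert nb by (simp add: 1 2 add.commute del: insert_iff cong: sum.cong)
qed simp

lemma finite_lr_max [simp]: "finite (lr_max N s)" by (auto simp: lr_max_def)

lemma finite_rl_exc [simp]: "finite (rl_exc N s)" by (auto simp: rl_exc_def)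

text \<open>Every left-to-right maximum stands weakly before every right-to-left maximum. Hence an insertion at a
left-to-right maximum keeps all the counted right-to-left maxima, and an insertion after one of the
latter keeps all left-to-right maxima: only one label is cut down at a time.\<close>

lemma sum_active_sites:
  fixes w :: "nat \<Rightarrow> nat \<Rightarrow> 'b::comm_monoid_add"
  assumes s: "fpf_involution N s"
  shows "(\<Sum>p\<in>active_sites N s. w (card (lr_max (N + 2) (add_cycle N s p))) (card (rl_exc (N + 2) (add_cycle N s p))))
    = (\<Sum>k<card (lr_max N s). w (k + 1) (card (rl_exc N s) + 1))
      + (\<Sum>k<card (rl_exc N s). w (card (lr_max N s) + 1) (k + 1)) + w (card (lr_max N s) + 1) 1"
    (is "sum ?f _ = _")
proof -
  let ?L = "lr_max N s" and ?R = "rl_exc N s"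
  have cL: "card (lr_max (N + 2) (add_cycle N s p)) = card {k \<in> ?L. k < p} + 1" if "p \<in> {1..N+1}" for p
    using lr_max_add_cycle[OF s that] by simp
  have cR: "card (rl_exc (N + 2) (add_cycle N s p)) = card {k \<in> ?R. p \<le> k} + 1" if "p \<in> {1..N+1}" for p
    using rl_exc_add_cycle[OF s that] by (simp add: card_image image_iff)
  have 1: "?f p = w (card {k \<in> ?L. k < p} + 1) (card ?R + 1)" if p: "p \<in> ?L" for p
  proof -
    have "{k \<in> ?R. p \<le> k} = ?R" using lr_max_le_rl_exc p by blast
    then show ?thesis using cL[of p] cR[of p] lr_maxD(1)[OF p] by simp
  qed
  have 2: "?f (Suc m) = w (card ?L + 1) (card {k \<in> ?R. m < k} + 1)" if m: "m \<in> ?R" for m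
  proof -
    have "{k \<in> ?L. k < Suc m} = ?L" using lr_max_le_rl_exc m by fastforce
    then show ?thesis using cL[of "Suc m"] cR[of "Suc m"] rl_excD(1)[OF m] by (simp add: Suc_le_eq)
  qed
  have 3: "?f (N + 1) = w (card ?L + 1) 1"
  proof -
    have e: "{k \<in> ?L. k < N + 1} = ?L" "{k \<in> ?R. N + 1 \<le> k} = {}"
      using lr_maxD(1) rl_excD(1) by fastforce+
    show ?thesis using cL[of "N + 1"] cR[of "N + 1"] unfolding e by simp
  qed
  have d1: "?L \<inter> Suc ` ?R = {}" using lr_max_le_rl_exc by fastforce
  have d2: "N + 1 \<notin> ?L \<union> Suc ` ?R"
  proof -
    have "N \<notin> ?R" using rl_excD(1,2)[of N N s] fpfD(2)[OF s, of N] by fastforce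
    then show ?thesis using lr_maxD(1)[of "N + 1" N s] by auto
  qed
  have "sum ?f (active_sites N s) = sum ?f ?L + sum ?f (Suc ` ?R) + ?f (N + 1)"
    unfolding active_sites_def using d1 d2 by (simp add: sum.union_disjoint add.commute)
  also have "sum ?f (Suc ` ?R) = (\<Sum>m\<in>?R. ?f (Suc m))" by (simp add: sum.reindex)
  finally show ?thesis
    using sum_rank_up[of ?L "\<lambda>k. w (k + 1) (card ?R + 1)"] sum_rank_down[of ?R "\<lambda>k. w (card ?L + 1) (k + 1)"]
    by (simp only: 1 2 3 finite_lr_max finite_rl_exc cong: sum.cong)
qed

lemma baxter_involutions_rec:
  fixes w :: "nat \<Rightarrow> nat \<Rightarrow> 'b::comm_monoid_add"
  shows "(\<Sum>q\<in>baxter_involutions (N + 2). w (card (lr_max (N + 2) q)) (card (rl_exc (N + 2) q)))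
    = (\<Sum>s\<in>baxter_involutions N. (\<Sum>k<card (lr_max N s). w (k + 1) (card (rl_exc N s) + 1))
      + (\<Sum>k<card (rl_exc N s). w (card (lr_max N s) + 1) (k + 1)) + w (card (lr_max N s) + 1) 1)"
proof -
  have fs: "finite (active_sites N s)" for s by (simp add: active_sites_def)
  have "(\<Sum>q\<in>baxter_involutions (N + 2). w (card (lr_max (N + 2) q)) (card (rl_exc (N + 2) q)))
    = (\<Sum>(s,p)\<in>Sigma (baxter_involutions N) (active_sites N). w (card (lr_max (N + 2) (add_cycle N s p))) (card (rl_exc (N + 2) (add_cycle N s p))))"
    using sum.reindex_bij_betw[OF baxter_involutions_step, of "\<lambda>q. w (card (lr_max (N + 2) q)) (card (rl_exc (N + 2) q))" N]
    by (simp add: case_prod_unfold)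
  also have "\<dots> = (\<Sum>s\<in>baxter_involutions N. \<Sum>p\<in>active_sites N s. w (card (lr_max (N + 2) (add_cycle N s p))) (card (rl_exc (N + 2) (add_cycle N s p))))"
    using finite_baxter_involutions fs by (simp add: sum.Sigma)
  also have "\<dots> = (\<Sum>s\<in>baxter_involutions N. (\<Sum>k<card (lr_max N s). w (k + 1) (card (rl_exc N s) + 1))
      + (\<Sum>k<card (rl_exc N s). w (card (lr_max N s) + 1) (k + 1)) + w (card (lr_max N s) + 1) 1)"
    by (intro sum.cong refl sum_active_sites) (simp add: baxter_involutions_def)
  finally show ?thesis .
qed

lemma lr_max_nonempty:
  assumes "fpf_involution N s" "0 < N" shows "0 < card (lr_max N s)"
proof -
  have "1 \<in> lr_max N s" using assms by (auto simp: lr_max_def)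
  then show ?thesis by (auto simp: card_gt_0_iff)
qed

text \<open>The position of the largest entry is an excedance because that entry is not fixed.\<close>

lemma rl_exc_nonempty:
  assumes s: "fpf_involution N s" "0 < N" shows "0 < card (rl_exc N s)"
proof -
  have N: "N \<in> {1..N}" using assms by simp
  have sN: "s N \<in> {1..N}" "s N < N" using fpfD(2,3)[OF s(1) N] by auto
  have "s i < s (s N)" if "s N < i" "i \<le> N" for i
  proof -
    have "s i \<le> N" using fpfD(2)[OF s(1), of i] that by auto
    moreover have "s i \<noteq> N" using fpfD(1)[OF s(1), of i] that by auto
    ultimately show ?thesis by (simp add: fpfD(1)[OF s(1)])
  qed
  then have "s N \<in> rl_exc N s" using sN by (auto simp: rl_exc_def fpfD(1)[OF s(1)])
  then show ?thesis by (auto simp: card_gt_0_iff)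
qed

section \<open>A lattice function with two antisymmetries\<close>

type_synonym lattice_fun = "int \<Rightarrow> int \<Rightarrow> real"

text \<open>In generating functions this is multiplication by
\<open>(1 + u)(1 + v)(u + v) / (u v) = 2 + u + v + 1/u + 1/v + u/v + v/u\<close>, which the hexagonal symmetry group
generated by \<open>u \<leftrightarrow> v\<close> and \<open>u \<mapsto> v/u\<close> leaves invariant.\<close>

definition hex_step :: "lattice_fun \<Rightarrow> lattice_fun" where
  "hex_step f a b = 2 * f a b + f (a - 1) b + f (a + 1) b + f a (b - 1) + f a (b + 1)
     + f (a - 1) (b + 1) + f (a + 1) (b - 1)"

text \<open>The values of \<open>start\<close> in the left half-plane are found by the algebraic kernel method: a weighted sum
over the images of \<open>u v\<close> under the group generated by \<open>(u, v) \<mapsto> (v/u, v)\<close> and \<open>(u, v) \<mapsto> (u, u/v)\<close>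
satisfies the antisymmetries, and the factors \<open>1/(1 - 1/u)\<close> and \<open>1/(1 - u/v)\<close> occurring in it,
expanded as geometric series, produce the rays. The exception at \<open>(-1, 1)\<close> marks the tip of a ray that begins one step later than the others.\<close>

definition left_half :: lattice_fun where
  "left_half a b = of_bool (b = 0) - of_bool (b = -1) - of_bool (b = 2) + of_bool (b = 1 \<and> a \<noteq> -1)"

definition start :: lattice_fun where
  "start a b = (if a < 0 then left_half a b else if a > 0 then - left_half (- a) (a + b) else 0)"

definition walk :: "nat \<Rightarrow> lattice_fun" where "walk n = (hex_step ^^ n) start"

text \<open>The map \<open>(a, b) \<mapsto> (-a, a + b)\<close> fixes the line \<open>a = 0\<close> pointwise.\<close>

definition antisym_left :: "lattice_fun \<Rightarrow> bool" where
  "antisym_left f \<longleftrightarrow> (\<forall>a b. f (- a) (a + b) = - f a b)"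

text \<open>Not \<open>f\<close> itself but its difference \<open>Y(a, b) = f(a, b) - f(a - 1, b + 1)\<close> is antisymmetric, under
\<open>(a, b) \<mapsto> (a + b, -b)\<close>; so \<open>Y\<close> vanishes on \<open>b = 0\<close>, and \<open>f\<close> satisfies a reflecting instead of an
absorbing boundary condition there.\<close>

definition antisym_bottom :: "lattice_fun \<Rightarrow> bool" where
  "antisym_bottom f \<longleftrightarrow> (\<forall>a b. f (a + b) (- b) - f (a + b - 1) (1 - b) = f (a - 1) (b + 1) - f a b)"

lemma antisym_left_hex_step: assumes "antisym_left f" shows "antisym_left (hex_step f)"
proof -
  have r: "f (- a) c = - f a (c - a)" for a c
    using assms unfolding antisym_left_def by (metis add_diff_cancel_left' diff_add_cancel add.commute)
  show ?thesis
    unfolding antisym_left_def hex_step_def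
    using r[of "a" for a] r[of "a + 1" for a] r[of "a - 1" for a]
    by (simp add: algebra_simps)
qed

lemma antisym_bottom_hex_step: assumes "antisym_bottom f" shows "antisym_bottom (hex_step f)"
proof -
  define Y where "Y a b = f a b - f (a - 1) (b + 1)" for a b
  have r: "Y (a + b) (- b) = - Y a b" for a b
    using assms unfolding antisym_bottom_def Y_def by (simp add: algebra_simps)
  have r': "Y x y = - Y (x + y) (- y)" for x y using r[of x y] by simp
  have h: "hex_step f a b - hex_step f (a - 1) (b + 1) = hex_step Y a b" for a b
    unfolding hex_step_def Y_def by (simp add: algebra_simps)
  have "hex_step Y (a + b) (- b) = - hex_step Y a b" for a b
    unfolding hex_step_def r'[of "a + b" "- b"] r'[of "a + b - 1" "- b"] r'[of "a + b + 1" "- b"]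
      r'[of "a + b" "- b - 1"] r'[of "a + b" "- b + 1"] r'[of "a + b - 1" "- b + 1"]
      r'[of "a + b + 1" "- b - 1"]
    by (simp add: algebra_simps)
  then have "hex_step f (a + b) (- b) - hex_step f (a + b - 1) (- b + 1) = - (hex_step f a b - hex_step f (a - 1) (b + 1))" for a b
    using h[of "a + b" "- b"] h[of a b] by simp
  then show ?thesis unfolding antisym_bottom_def by simp
qed

lemma antisym_left_start: "antisym_left start"
  unfolding antisym_left_def start_def by auto

lemma antisym_bottom_start: "antisym_bottom start"
  unfolding antisym_bottom_def start_def left_half_def of_bool_def
  by (intro allI) (auto split: if_splits)

lemma walk_antisym: "antisym_left (walk n)" "antisym_bottom (walk n)"
  by (induction n) (simp_all add: walk_def antisym_left_start antisym_bottom_start antisym_left_hex_step antisym_bottom_hex_step)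

text \<open>The two antisymmetries yield the boundary values on the lines \<open>a = 0\<close> and \<open>b = 0\<close>.\<close>

lemma walk_zero_left: "walk n 0 b = 0"
  using walk_antisym(1)[of n] unfolding antisym_left_def by (metis add_0 equal_neg_zero neg_equal_0_iff_equal)

lemma walk_bottom: "walk n (a + 1) 0 = walk n a 1"
  using walk_antisym(2)[of n, unfolded antisym_bottom_def, rule_format, of "a + 1" 0] by simp

lemma walk_start: "a \<ge> 1 \<Longrightarrow> b \<ge> 1 \<Longrightarrow> walk 0 a b = of_bool (a = 1 \<and> b = 1)"
  by (auto simp: walk_def start_def left_half_def)

section \<open>Evaluation by hexagonal symmetry\<close>

text \<open>The value after \<open>n\<close> steps at the origin, the common fixed point of the symmetries of the hexagon; it is
a linear functional of the initial function that only depends on its orbit under these symmetries.\<close>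

definition at_origin :: "nat \<Rightarrow> lattice_fun \<Rightarrow> real" where "at_origin n f = (hex_step ^^ n) f 0 0"

lemma hex_step_lin: "hex_step (\<lambda>a b. c * f a b + d * g a b) = (\<lambda>a b. c * hex_step f a b + d * hex_step g a b)"
  unfolding hex_step_def by (intro ext) (simp add: algebra_simps)

lemma hexn_lin: "(hex_step ^^ n) (\<lambda>a b. c * f a b + d * g a b) = (\<lambda>a b. c * (hex_step ^^ n) f a b + d * (hex_step ^^ n) g a b)"
  by (induction n) (simp_all add: hex_step_lin)

lemma at_origin_lin: "at_origin n (\<lambda>a b. c * f a b + d * g a b) = c * at_origin n f + d * at_origin n g"
  unfolding at_origin_def by (simp add: hexn_lin)

lemma at_origin_add: "at_origin n (\<lambda>a b. f a b + g a b) = at_origin n f + at_origin n g"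
  using at_origin_lin[of n 1 f 1 g] by simp

lemma at_origin_diff: "at_origin n (\<lambda>a b. f a b - g a b) = at_origin n f - at_origin n g"
  using at_origin_lin[of n 1 f "-1" g] by simp

text \<open>Two reflections generate the symmetry group of the hexagon; with translations this is all that is
needed.\<close>

lemma hexn_swap: "(hex_step ^^ n) (\<lambda>a b. f b a) = (\<lambda>a b. (hex_step ^^ n) f b a)"
proof (induction n)
  case (Suc n)
  then show ?case by (simp add: Suc hex_step_def algebra_simps fun_eq_iff)
qed simp

lemma hexn_refl: "(hex_step ^^ n) (\<lambda>a b. f (- a) (a + b)) = (\<lambda>a b. (hex_step ^^ n) f (- a) (a + b))"
proof (induction n)
  case (Suc n)
  then show ?case by (simp add: Suc hex_step_def algebra_simps fun_eq_iff)
qed simp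

lemma hexn_shift: "(hex_step ^^ n) (\<lambda>a b. f (a + c) (b + d)) = (\<lambda>a b. (hex_step ^^ n) f (a + c) (b + d))"
proof (induction n)
  case (Suc n)
  then show ?case by (simp add: Suc hex_step_def algebra_simps fun_eq_iff)
qed simp

lemma at_origin_swap: "at_origin n (\<lambda>a b. f b a) = at_origin n f"
  using fun_cong[OF fun_cong[OF hexn_swap[of n f], of 0], of 0] by (simp add: at_origin_def)

lemma at_origin_refl: "at_origin n (\<lambda>a b. f (- a) (a + b)) = at_origin n f"
  using fun_cong[OF fun_cong[OF hexn_refl[of n f], of 0], of 0] by (simp add: at_origin_def)

lemma at_origin_rot: "at_origin n (\<lambda>a b. f (a + b) (- a)) = at_origin n f"
  using at_origin_refl[of n "\<lambda>a b. f b a"] at_origin_swap[of n f] by simp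

lemma at_origin_rot2: "at_origin n (\<lambda>a b. f b (- a - b)) = at_origin n f"
  using at_origin_rot[of n "\<lambda>a b. f (a + b) (- a)"] at_origin_rot[of n f] by (simp add: algebra_simps)

lemma at_origin_neg: "at_origin n (\<lambda>a b. f (- a) (- b)) = at_origin n f"
  using at_origin_rot[of n "\<lambda>a b. f b (- a - b)"] at_origin_rot2[of n f] by (simp add: algebra_simps)

lemma at_origin_mirror: "at_origin n (\<lambda>a b. f (- a - b) b) = at_origin n f"
  using at_origin_rot2[of n "\<lambda>a b. f b a"] at_origin_swap[of n f] by simp

lemma at_origin_up: "at_origin n (\<lambda>a b. f (a + b) (- b)) = at_origin n f"
  using at_origin_mirror[of n "\<lambda>a b. f (- a) (- b)"] at_origin_neg[of n f] by (simp add: algebra_simps)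

definition point :: "int \<Rightarrow> int \<Rightarrow> lattice_fun" where "point c d a b = of_bool (a = c \<and> b = d)"

definition ray :: "int \<Rightarrow> int \<Rightarrow> lattice_fun" where "ray c d a b = of_bool (a \<ge> c \<and> b = d)"

definition row :: "int \<Rightarrow> lattice_fun" where "row d a b = of_bool (b = d)"

text \<open>The reflection \<open>(a, b) \<mapsto> (-a - b, b)\<close> preserves every row and maps the complement of a ray within its
row to a ray.\<close>

lemma at_origin_ray_row: "at_origin n (ray c d) + at_origin n (ray (1 - c - d) d) = at_origin n (row d)"
proof -
  have "row d = (\<lambda>a b. ray c d a b + ray (1 - c - d) d (- a - b) b)"
    by (auto simp: fun_eq_iff row_def ray_def)
  then show ?thesis using at_origin_add[of n "ray c d" "\<lambda>a b. ray (1 - c - d) d (- a - b) b"]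
      at_origin_mirror[of n "ray (1 - c - d) d"] by simp
qed

lemma at_origin_ray_down: "at_origin n (ray c (- d)) = at_origin n (ray (c - d) d)"
proof -
  have "ray (c - d) d = (\<lambda>a b. ray c (- d) (a + b) (- b))"
    by (auto simp: fun_eq_iff ray_def)
  then show ?thesis using at_origin_up[of n "ray c (- d)"] by simp
qed

lemma at_origin_ray_step: "at_origin n (ray c d) = at_origin n (point c d) + at_origin n (ray (c + 1) d)"
proof -
  have "ray c d = (\<lambda>a b. point c d a b + ray (c + 1) d a b)"
    by (auto simp: fun_eq_iff ray_def point_def)
  then show ?thesis using at_origin_add[of n "point c d" "ray (c + 1) d"] by simp
qed

lemma at_origin_point: "at_origin n (point c d) = at_origin n (point d c)" "at_origin n (point c d) = at_origin n (point (- c) (c + d))"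
proof -
  have "point d c = (\<lambda>a b. point c d b a)" "point (- c) (c + d) = (\<lambda>a b. point c d (- a) (a + b))"
    by (auto simp: fun_eq_iff point_def)
  then show "at_origin n (point c d) = at_origin n (point d c)" "at_origin n (point c d) = at_origin n (point (- c) (c + d))"
    using at_origin_swap[of n "point c d"] at_origin_refl[of n "point c d"] by simp_all
qed

text \<open>Extending the lower index to negative integers by \<open>0\<close> makes Pascal's rule hold without exception.\<close>

definition binom :: "nat \<Rightarrow> int \<Rightarrow> real" where "binom n k = (if k < 0 then 0 else real (n choose nat k))"

lemma binom_Suc: "binom (Suc n) k = binom n k + binom n (k - 1)"
proof (cases "k \<le> 0")
  case True then show ?thesis by (auto simp: binom_def)
next
  case False
  then have "nat k = Suc (nat (k - 1))" by simp
  then show ?thesis using False by (simp add: binom_def)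
qed

text \<open>On a function of \<open>b\<close> alone, \<open>hex_step\<close> has the symbol \<open>2 (1 + v)\<^sup>2 / v\<close>, the value at \<open>u = 1\<close>.\<close>

lemma hexn_row: "(hex_step ^^ n) (row d) a b = 2 ^ n * binom (2 * n) (int n + b - d)"
proof (induction n arbitrary: a b)
  case 0 show ?case by (auto simp: row_def binom_def)
next
  case (Suc n)
  have *: "binom (2 * Suc n) (int (Suc n) + b - d) = binom (2 * n) (int n + b - d - 1)
     + 2 * binom (2 * n) (int n + b - d) + binom (2 * n) (int n + b - d + 1)"
    by (simp add: binom_Suc algebra_simps)
  show ?case unfolding * by (simp add: Suc hex_step_def[of "(hex_step ^^ n) (row d)"]) (simp add: algebra_simps)
qed

lemma at_origin_row: "at_origin n (row (- int d)) = 2 ^ n * real ((2 * n) choose (n + d))"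
  unfolding at_origin_def hexn_row by (simp add: binom_def nat_add_distrib)

lemma at_origin_row_neg: "at_origin n (row (- d)) = at_origin n (row d)"
proof -
  have "row d = (\<lambda>a b. row (- d) (- a) (- b))" by (auto simp: row_def fun_eq_iff)
  then show ?thesis using at_origin_neg[of n "row (- d)"] by simp
qed

lemma walk_one_one: "walk n 1 1 = at_origin n (\<lambda>a b. start (a + 1) (b + 1))"

  using fun_cong[OF fun_cong[OF hexn_shift[of n start 1 1], of 0], of 0] by (simp add: at_origin_def walk_def)

text \<open>Seen from \<open>(1, 1)\<close>, the four rays in the left half-plane point in the direction of \<open>(-1, 0)\<close> and the
four in the right half-plane in the direction of \<open>(1, -1)\<close>; a half-turn and the reflection
\<open>(a, b) \<mapsto> (a, -a - b)\<close> make them horizontal.\<close>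

lemma start_decomp:
  "start (a + 1) (b + 1) = point 0 0 a b - point (-2) 1 a b
    + (ray 3 0 (- a) (- b) - ray 3 (-1) (- a) (- b) - ray 2 2 (- a) (- b) + ray 2 1 (- a) (- b))
    + (ray 0 3 a (- a - b) - ray 0 2 a (- a - b) - ray 1 1 a (- a - b) + ray 1 0 a (- a - b))"
  unfolding start_def left_half_def ray_def point_def of_bool_def
  by auto

lemma at_origin_anti: "at_origin n (\<lambda>a b. f a (- a - b)) = at_origin n f"
  using at_origin_refl[of n "\<lambda>a b. f (- a) (- b)"] at_origin_neg[of n f] by (simp add: algebra_simps)

text \<open>The horizontal rays either cancel or are, up to single points, halves of the rows \<open>0\<close> to \<open>3\<close>. The
leftover points cancel in pairs that lie on the same orbit of the hexagon group.\<close>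

lemma walk_one_one_rows:
  "walk n 1 1 = at_origin n (row 0) - at_origin n (row 1) / 2 - at_origin n (row 2) + at_origin n (row 3) / 2"
proof -
  have "walk n 1 1 = at_origin n (point 0 0) - at_origin n (point (-2) 1)
    + (at_origin n (ray 3 0) - at_origin n (ray 3 (-1)) - at_origin n (ray 2 2) + at_origin n (ray 2 1))
    + (at_origin n (ray 0 3) - at_origin n (ray 0 2) - at_origin n (ray 1 1) + at_origin n (ray 1 0))"
    unfolding walk_one_one start_decomp by (simp only: at_origin_add at_origin_diff at_origin_neg at_origin_anti)
  moreover have "at_origin n (ray 3 (-1)) = at_origin n (ray 2 1)" using at_origin_ray_down[of n 3 1] by simp
  moreover have "at_origin n (ray 1 0) + at_origin n (ray 0 0) = at_origin n (row 0)" using at_origin_ray_row[of n 1 0] by simp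
  moreover have "2 * at_origin n (ray 0 1) = at_origin n (row 1)" using at_origin_ray_row[of n 0 1] by simp
  moreover have "at_origin n (ray 0 2) + at_origin n (ray (-1) 2) = at_origin n (row 2)" using at_origin_ray_row[of n 0 2] by simp
  moreover have "2 * at_origin n (ray (-1) 3) = at_origin n (row 3)" using at_origin_ray_row[of n "-1" 3] by simp
  moreover have "at_origin n (ray 0 0) = at_origin n (point 0 0) + at_origin n (point 1 0) + at_origin n (point 2 0) + at_origin n (ray 3 0)"
    "at_origin n (ray 1 0) = at_origin n (point 1 0) + at_origin n (point 2 0) + at_origin n (ray 3 0)"
    using at_origin_ray_step[of n 0 0] at_origin_ray_step[of n 1 0] at_origin_ray_step[of n 2 0] by simp_all
  moreover have "at_origin n (ray 0 1) = at_origin n (point 0 1) + at_origin n (ray 1 1)" using at_origin_ray_step[of n 0 1] by simp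
  moreover have "at_origin n (ray (-1) 2) = at_origin n (point (-1) 2) + at_origin n (ray 0 2)"
    "at_origin n (ray 0 2) = at_origin n (point 0 2) + at_origin n (point 1 2) + at_origin n (ray 2 2)"
    using at_origin_ray_step[of n "-1" 2] at_origin_ray_step[of n 0 2] at_origin_ray_step[of n 1 2] by simp_all
  moreover have "at_origin n (ray (-1) 3) = at_origin n (point (-1) 3) + at_origin n (ray 0 3)" using at_origin_ray_step[of n "-1" 3] by simp
  moreover have "at_origin n (point 0 1) = at_origin n (point 1 0)" "at_origin n (point 0 2) = at_origin n (point 2 0)"
    "at_origin n (point (-1) 2) = at_origin n (point (-2) 1)" "at_origin n (point (-1) 3) = at_origin n (point 1 2)"
    using at_origin_point(1)[of n 0 1] at_origin_point(1)[of n 0 2] at_origin_point(1)[of n "-1" 2] at_origin_point(2)[of n 2 "-1"]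
      at_origin_point(1)[of n "-2" 1] at_origin_point(2)[of n 1 2] at_origin_point(2)[of n 1 1] by simp_all
  ultimately show ?thesis by linarith
qed

lemma choose_rec: "real (k + 1) * real (m choose (k + 1)) = (real m - real k) * real (m choose k)"
proof -
  have "real (Suc k) * real (Suc m choose Suc k) = real (Suc m) * real (m choose k)"
    using Suc_times_binomial[of k m] by (metis of_nat_mult)
  then show ?thesis by (simp add: algebra_simps)
qed

lemma walk_one_one_closed:
  "walk n 1 1 = 3 * 2 ^ n / ((real n + 2) * (real n + 3)) * real ((2 * (n + 1)) choose (n + 1))"
proof -
  define c where "c d = real ((2 * n) choose (n + d))" for d
  have r: "at_origin n (row (int d)) = 2 ^ n * c d" for d
    using at_origin_row[of n d] at_origin_row_neg[of n "int d"] by (simp add: c_def)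
  have c: "(real n + real d + 1) * c (d + 1) = (real n - real d) * c d" for d
    using choose_rec[of "n + d" "2 * n"] by (simp add: c_def algebra_simps)
  have c1: "c 1 = real n * c 0 / (real n + 1)" using c[of 0] by (simp add: field_simps)
  have c2: "c 2 = (real n - 1) * c 1 / (real n + 2)" using c[of 1, unfolded one_add_one] by (simp add: field_simps)
  have c3: "c 3 = (real n - 2) * c 2 / (real n + 3)" using c[of 2] by (simp add: field_simps numeral_3_eq_3)
  have b: "real ((2 * (n + 1)) choose (n + 1)) = 2 * (c 0 + c 1)"
  proof -
    have "(2 * n choose (n + 1)) = (2 * n choose (n - 1))" if "n \<ge> 1"
      using that binomial_symmetric[of "n + 1" "2 * n"] by simp
    then show ?thesis by (cases n) (simp_all add: c_def)
  qed
  have "walk n 1 1 = 2 ^ n * (c 0 - c 1 / 2 - c 2 + c 3 / 2)"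
    using walk_one_one_rows[of n] r[of 0] r[of 1] r[of 2] r[of 3] by (simp add: algebra_simps)
  also have "c 0 - c 1 / 2 - c 2 + c 3 / 2 = 6 * (c 0 + c 1) / ((real n + 2) * (real n + 3))"
  proof -
    have p: "real n + 1 \<noteq> 0" "real n + 2 \<noteq> 0" "real n + 3 \<noteq> 0" by linarith+
    show ?thesis unfolding c3 c2 c1 using p by (simp add: divide_simps) (simp add: algebra_simps power2_eq_square)
  qed
  finally show ?thesis unfolding b by simp
qed

section \<open>Counting the involutions by the lattice function\<close>

text \<open>This is \<open>D\<^bsub>n+1\<^esub>(x + 1, y + 1)\<close> in the notation of the introduction. The binomial weights turn the sums over
\<open>k < i\<close> in the generating tree into single binomials; subtracting \<open>1\<close> loses nothing because both labels
are positive as soon as there is a cycle.\<close>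

definition label_moment :: "nat \<Rightarrow> nat \<Rightarrow> nat \<Rightarrow> real" where
  "label_moment n x y = (\<Sum>s\<in>baxter_involutions (2 * n + 2).
     real ((card (lr_max (2 * n + 2) s) - 1) choose x) * real ((card (rl_exc (2 * n + 2) s) - 1) choose y))"

lemma sum_choose_lessThan: "(\<Sum>k<i. real (k choose x)) = real (i choose (x + 1))"
  by (induction i) simp_all

lemma label_moment_0: "label_moment 0 x y = of_bool (x = 0 \<and> y = 0)"
proof -
  have "fpf_involution 0 s \<longleftrightarrow> s = id" for s by (auto simp: fpf_involution_def fun_eq_iff)
  moreover have "avoids 0 s" for s by (rule avoidsI) auto
  ultimately have "baxter_involutions 0 = {id}" by (auto simp: baxter_involutions_def)
  then show ?thesis
    using baxter_involutions_rec[of "\<lambda>i j. real ((i - 1) choose x) * real ((j - 1) choose y)" 0]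
    by (simp add: label_moment_def lr_max_def rl_exc_def binomial_eq_0_iff)
qed

lemma label_moment_Suc:
  "label_moment (Suc n) x y = 2 * label_moment n x y + label_moment n (x + 1) y + label_moment n x (y + 1)
     + of_bool (x \<ge> 1) * (label_moment n (x - 1) y + label_moment n (x - 1) (y + 1))
     + of_bool (y \<ge> 1) * (label_moment n x (y - 1) + label_moment n (x + 1) (y - 1))
     + of_bool (y = 0) * (label_moment n x 0 + of_bool (x \<ge> 1) * label_moment n (x - 1) 0)"
proof -
  define N where "N = 2 * n + 2"
  define i where "i s = card (lr_max N s)" for s
  define j where "j s = card (rl_exc N s)" for s
  have z: "real (0 choose y) = of_bool (y = 0)" by (cases y) simp_all
  have "label_moment (Suc n) x y = (\<Sum>s\<in>baxter_involutions N. (\<Sum>k<i s. real (k choose x)) * real (j s choose y)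
      + real (i s choose x) * (\<Sum>k<j s. real (k choose y)) + real (i s choose x) * real (0 choose y))"
    using baxter_involutions_rec[of "\<lambda>i j. real ((i - 1) choose x) * real ((j - 1) choose y)" N]
    by (simp add: label_moment_def N_def i_def j_def sum_distrib_left sum_distrib_right)
  also have "\<dots> = (\<Sum>s\<in>baxter_involutions N. real (i s choose (x + 1)) * real (j s choose y)
      + real (i s choose x) * real (j s choose (y + 1)) + real (i s choose x) * of_bool (y = 0))"
    unfolding sum_choose_lessThan z ..
  also have "\<dots> = (\<Sum>s\<in>baxter_involutions N. 2 * (real ((i s - 1) choose x) * real ((j s - 1) choose y))
      + real ((i s - 1) choose (x + 1)) * real ((j s - 1) choose y)
      + real ((i s - 1) choose x) * real ((j s - 1) choose (y + 1))
      + of_bool (x \<ge> 1) * (real ((i s - 1) choose (x - 1)) * real ((j s - 1) choose y)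
          + real ((i s - 1) choose (x - 1)) * real ((j s - 1) choose (y + 1)))
      + of_bool (y \<ge> 1) * (real ((i s - 1) choose x) * real ((j s - 1) choose (y - 1))
          + real ((i s - 1) choose (x + 1)) * real ((j s - 1) choose (y - 1)))
      + of_bool (y = 0) * (real ((i s - 1) choose x) * real ((j s - 1) choose 0)
          + of_bool (x \<ge> 1) * (real ((i s - 1) choose (x - 1)) * real ((j s - 1) choose 0))))"
  proof (rule sum.cong[OF refl])
    fix s assume "s \<in> baxter_involutions N"
    then have s: "fpf_involution N s" by (simp add: baxter_involutions_def)
    have "0 < N" by (simp add: N_def)
    then obtain a b where ab: "i s = Suc a" "j s = Suc b"
      using lr_max_nonempty[OF s] rl_exc_nonempty[OF s] unfolding i_def j_def by (metis gr0_implies_Suc)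
    show "real (i s choose (x + 1)) * real (j s choose y)
      + real (i s choose x) * real (j s choose (y + 1)) + real (i s choose x) * of_bool (y = 0) =
      2 * (real ((i s - 1) choose x) * real ((j s - 1) choose y))
      + real ((i s - 1) choose (x + 1)) * real ((j s - 1) choose y)
      + real ((i s - 1) choose x) * real ((j s - 1) choose (y + 1))
      + of_bool (x \<ge> 1) * (real ((i s - 1) choose (x - 1)) * real ((j s - 1) choose y)
          + real ((i s - 1) choose (x - 1)) * real ((j s - 1) choose (y + 1)))
      + of_bool (y \<ge> 1) * (real ((i s - 1) choose x) * real ((j s - 1) choose (y - 1))
          + real ((i s - 1) choose (x + 1)) * real ((j s - 1) choose (y - 1)))
      + of_bool (y = 0) * (real ((i s - 1) choose x) * real ((j s - 1) choose 0)
          + of_bool (x \<ge> 1) * (real ((i s - 1) choose (x - 1)) * real ((j s - 1) choose 0)))"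
      unfolding ab by (cases x; cases y) (simp_all add: algebra_simps)
  qed
  finally show ?thesis
    by (simp only: sum.distrib flip: sum_distrib_left) (simp only: label_moment_def N_def i_def j_def)
qed

text \<open>Both functions satisfy the same recurrence inside the quadrant; what \<open>hex_step\<close> reads outside of it is
supplied by the boundary values, of which the lower one produces the term for \<open>y = 0\<close> in \<open>label_moment_Suc\<close>.\<close>

lemma label_moment_eq_walk: "label_moment n x y = walk n (int x + 1) (int y + 1)"
proof (induction n arbitrary: x y)
  case 0
  show ?case by (simp add: label_moment_0 walk_start)
next
  case (Suc n)
  have left: "of_bool (x \<ge> 1) * label_moment n (x - 1) y' = walk n (int x) (int y' + 1)" for y'
    by (cases x) (simp_all add: Suc walk_zero_left add.commute)
  have low: "of_bool (y \<ge> 1) * label_moment n x' (y - 1) + of_bool (y = 0) * walk n (int x') 1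
      = walk n (int x' + 1) (int y)" for x'
    by (cases y) (use walk_bottom[of n "int x'"] in \<open>simp_all add: Suc add.commute\<close>)
  have "label_moment (Suc n) x y = 2 * label_moment n x y + label_moment n (x + 1) y + label_moment n x (y + 1)
     + of_bool (x \<ge> 1) * label_moment n (x - 1) y + of_bool (x \<ge> 1) * label_moment n (x - 1) (y + 1)
     + (of_bool (y \<ge> 1) * label_moment n x (y - 1) + of_bool (y = 0) * (of_bool (x \<ge> 1) * label_moment n (x - 1) 0))
     + (of_bool (y \<ge> 1) * label_moment n (x + 1) (y - 1) + of_bool (y = 0) * label_moment n x 0)"
    by (simp add: label_moment_Suc algebra_simps)
  also have "\<dots> = hex_step (walk n) (int x + 1) (int y + 1)"
    unfolding left using low[of x] low[of "x + 1"] by (simp add: Suc hex_step_def algebra_simps)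
  finally show ?case by (simp add: walk_def)
qed

theorem theorem6:
  fixes n :: nat
  assumes "n \<ge> 1"
  shows "real (card {p. baxter_perm (2 * n) p \<and> involutive_perm p \<and> (\<forall>i\<in>{1..2 * n}. p i \<noteq> i)})
    = 3 * 2 ^ (n - 1) / ((real n + 1) * (real n + 2)) * real ((2 * n) choose n)"
proof -
  obtain m where n: "n = m + 1" using assms by (metis add.commute le_Suc_ex)
  have "{p. baxter_perm (2 * n) p \<and> involutive_perm p \<and> (\<forall>i\<in>{1..2 * n}. p i \<noteq> i)} = baxter_involutions (2 * n)"
    unfolding baxter_involutions_def baxter_perm_def avoids_def using fpf_iff[of _ "2 * n"] by blast
  moreover have "real (card (baxter_involutions (2 * n))) = label_moment m 0 0" by (simp add: label_moment_def n)
  ultimately show ?thesis by (simp only: label_moment_eq_walk) (use walk_one_one_closed[of m] in \<open>simp add: n algebra_simps\<close>)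
qed

end
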